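(* Let $n\ge 1$, $d_X,d_Z\ge 1$ be any fixed integers. Let $p_Z$ be any given probability density (with respect to Lebesgue measure) on $[0,1]^{d_Z}$. For any constants $\beta>0$, $W_1>0$ and $\varepsilon>0$ there exists a finite class $\mathcal{C}(\beta,W_1)$ of distributions on $[0,1]^{d_X+d_Z}$ (whose cardinality depends on $n$ and $\varepsilon$) such that: (i) for every distribution in the class, the marginal distribution of $Z$ is absolutely continuous with respect to Lebesgue measure on $[0,1]^{d_Z}$, with density equal to $p_Z$; (ii) for every distribution in the class, the conditional densities $p_{X|Z}$ are Hölder smooth with constant $W_1$ and smoothness $\beta$; (iii) $$\inf_{\hat p}\ \max_{p\in\mathcal{C}(\beta,W_1)} \mathbb{E}_p\int\int |\hat p_{X|Z}(x|z)-p_{X|Z}(x|z)|\,p_Z(z)\,dx\,dz\ \ge\ \kappa-\varepsilon,$$ where $\kappa=\frac{W_1^2 d_X^{2\beta-1}}{144}$ if $\beta\le 1$ and $W_1<\frac{2}{d_X^{\beta}}$, and $\kappa=\frac{1}{36 d_X}$ otherwise.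
   Context: Random variables $X\in[0,1]^{d_X}$, $Z\in[0,1]^{d_Z}$ have a joint distribution $p=p_{X,Z}=p_{X|Z}\cdot p_Z$, absolutely continuous with respect to Lebesgue measure on $[0,1]^{d_X+d_Z}$. An estimator $\hat p=\hat p_{X|Z}$ is any (measurable) function of the data $(X_1,Z_1),\dots,(X_n,Z_n)$, which are i.i.d. from $p$; $\mathbb{E}_p$ denotes expectation over the $n$ i.i.d. samples from $p$, and the infimum is over all estimators. Integrals in $x$ and $z$ are over $[0,1]^{d_X}$ and $[0,1]^{d_Z}$. Hölder smoothness. For $\beta>0$, $\lfloor\beta\rfloor$ denotes the greatest integer strictly less than $\beta$. For $\alpha\in\mathbb{N}_0^{d_X}$ (with $\mathbb{N}_0=\mathbb{N}\cup\{0\}$), $\|\alpha\|_1=\sum_i\alpha_i$ and $D^\alpha f=\partial^{\|\alpha\|_1}f/\partial x_1^{\alpha_1}\cdots\partial x_{d_X}^{\alpha_{d_X}}$. The collection of conditional densities $p_{X|Z}(\cdot|z)$, $z\in[0,1]^{d_Z}$, is Hölder smooth with constant $W_1>0$ and smoothness $\beta>0$ if, with $\ell=\lfloor\beta\rfloor$, it is $\ell$ times differentiable in $x$ and for all $x,x'\in[0,1]^{d_X}$, $z\in[0,1]^{d_Z}$ and all $\alpha\in\mathbb{N}_0^{d_X}$ with $\|\alpha\|_1=\ell$, $$|D^\alpha p_{X|Z}(x|z)-D^\alpha p_{X|Z}(x'|z)|\le W_1\|x-x'\|_1^{\beta-\ell}.$$ *)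

theory Defs
  imports "HOL-Probability.Probability"
begin

definition unit_cube :: "(real ^ 'n) set" where
  "unit_cube = {x. \<forall>i. 0 \<le> x $ i \<and> x $ i \<le> 1}"

text \<open>Lebesgue measure on the Borel sets of the cube \<open>[0,1]\<^sup>n\<close>.\<close>

definition cube_lebesgue :: "(real ^ 'n) measure" where
  "cube_lebesgue = restrict_space lborel unit_cube"

definition is_cube_density :: "(real ^ 'n \<Rightarrow> real) \<Rightarrow> bool" where
  "is_cube_density f \<longleftrightarrow>
     f \<in> borel_measurable cube_lebesgue \<and>
     (\<forall>x\<in>unit_cube. 0 \<le> f x) \<and>
     (\<integral>\<^sup>+ x. ennreal (f x) \<partial>cube_lebesgue) = 1"

definition ac_distribution :: "((real ^ 'dx) \<times> (real ^ 'dz)) measure \<Rightarrow> bool" where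
  "ac_distribution P \<longleftrightarrow>
     prob_space P \<and>
     sets P = sets (cube_lebesgue \<Otimes>\<^sub>M cube_lebesgue) \<and>
     absolutely_continuous (cube_lebesgue \<Otimes>\<^sub>M cube_lebesgue) P"

definition has_Z_marginal_density ::
    "((real ^ 'dx) \<times> (real ^ 'dz)) measure \<Rightarrow> (real ^ 'dz \<Rightarrow> real) \<Rightarrow> bool" where
  "has_Z_marginal_density P f \<longleftrightarrow>
     distr P cube_lebesgue snd = density cube_lebesgue (\<lambda>z. ennreal (f z))"

text \<open>
  \<open>q x z\<close> stands for \<open>p\<^bsub>X|Z\<^esub>(x|z)\<close>, and \<open>f\<close> is the density of \<open>Z\<close> under \<open>P\<close>.  Such a \<open>q\<close> is a
  version of the conditional density, determined by \<open>P\<close> and \<open>f\<close> only up to null sets of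
  \<open>f(z) dx dz\<close>; it is required to be a probability density in \<open>x\<close> for \<^emph>\<open>every\<close> \<open>z\<close> in the cube.
\<close>

definition is_conditional_density ::
    "((real ^ 'dx) \<times> (real ^ 'dz)) measure \<Rightarrow> (real ^ 'dz \<Rightarrow> real) \<Rightarrow>
     (real ^ 'dx \<Rightarrow> real ^ 'dz \<Rightarrow> real) \<Rightarrow> bool" where
  "is_conditional_density P f q \<longleftrightarrow>
     (\<lambda>(x, z). q x z) \<in> borel_measurable (cube_lebesgue \<Otimes>\<^sub>M cube_lebesgue) \<and>
     (\<forall>z\<in>unit_cube. is_cube_density (\<lambda>x. q x z)) \<and>
     P = density (cube_lebesgue \<Otimes>\<^sub>M cube_lebesgue) (\<lambda>(x, z). ennreal (q x z * f z))"

text \<open>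
  Partial derivatives are taken within the closed cube, hence are one-sided on its faces.
\<close>

definition partial_deriv :: "'n \<Rightarrow> (real ^ 'n \<Rightarrow> real) \<Rightarrow> real ^ 'n \<Rightarrow> real" where
  "partial_deriv i f x =
     vector_derivative (\<lambda>t. f (x + t *\<^sub>R axis i 1))
       (at 0 within {t. x + t *\<^sub>R axis i 1 \<in> unit_cube})"

primrec times_differentiable :: "nat \<Rightarrow> (real ^ 'n \<Rightarrow> real) \<Rightarrow> bool" where
  "times_differentiable 0 f \<longleftrightarrow> True"
| "times_differentiable (Suc k) f \<longleftrightarrow>
     f differentiable_on unit_cube \<and> (\<forall>i. times_differentiable k (partial_deriv i f))"

text \<open>
  A fixed numbering of the coordinates, so that the order of the partial derivatives in
  \<open>D\<^sup>\<alpha>\<close> is specified (the derivatives in the last coordinate of the list are taken first).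
  For \<open>\<parallel>\<alpha>\<parallel>\<^sub>1\<close> times differentiable functions the order is immaterial.
\<close>

definition coordinates :: "('n :: finite) list" where
  "coordinates = (SOME is. distinct is \<and> set is = UNIV)"

definition multi_deriv :: "('n \<Rightarrow> nat) \<Rightarrow> (real ^ 'n \<Rightarrow> real) \<Rightarrow> real ^ 'n \<Rightarrow> real" where
  "multi_deriv \<alpha> f = foldr (\<lambda>i g. (partial_deriv i ^^ \<alpha> i) g) coordinates f"

definition l1_norm :: "real ^ 'n \<Rightarrow> real" where
  "l1_norm x = (\<Sum>i\<in>UNIV. \<bar>x $ i\<bar>)"

text \<open>
  The greatest integer strictly smaller than \<open>\<beta>\<close>; it is a natural number as \<open>\<beta> > 0\<close>.
\<close>

definition strict_floor :: "real \<Rightarrow> nat" where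
  "strict_floor \<beta> = (GREATEST k. real k < \<beta>)"

definition holder_smooth ::
    "real \<Rightarrow> real \<Rightarrow> (real ^ 'dx \<Rightarrow> real ^ 'dz \<Rightarrow> real) \<Rightarrow> bool" where
  "holder_smooth W \<beta> q \<longleftrightarrow>
     (\<forall>z\<in>unit_cube. times_differentiable (strict_floor \<beta>) (\<lambda>x. q x z)) \<and>
     (\<forall>x\<in>unit_cube. \<forall>x'\<in>unit_cube. \<forall>z\<in>unit_cube. \<forall>\<alpha>.
        (\<Sum>i\<in>UNIV. \<alpha> i) = strict_floor \<beta> \<longrightarrow>
        \<bar>multi_deriv \<alpha> (\<lambda>x. q x z) x - multi_deriv \<alpha> (\<lambda>x. q x z) x'\<bar>
          \<le> W * l1_norm (x - x') powr (\<beta> - real (strict_floor \<beta>)))"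

text \<open>
  Estimators are measurable jointly in the data and in \<open>(x, z)\<close>, which makes the loss a
  measurable function of the data.  Their values need not be conditional densities.
\<close>

definition estimators ::
    "nat \<Rightarrow> ((nat \<Rightarrow> (real ^ 'dx) \<times> (real ^ 'dz)) \<Rightarrow> real ^ 'dx \<Rightarrow> real ^ 'dz \<Rightarrow> real) set" where
  "estimators n =
     {p_hat. (\<lambda>(D, x, z). p_hat D x z) \<in> borel_measurable
        (PiM {..<n} (\<lambda>_. cube_lebesgue \<Otimes>\<^sub>M cube_lebesgue) \<Otimes>\<^sub>M (cube_lebesgue \<Otimes>\<^sub>M cube_lebesgue))}"

text \<open>The loss may be infinite, so the risk takes values in \<open>[0,\<infinity>]\<close>.\<close>

definition L1_loss ::
    "(real ^ 'dz \<Rightarrow> real) \<Rightarrow> (real ^ 'dx \<Rightarrow> real ^ 'dz \<Rightarrow> real) \<Rightarrow>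
     (real ^ 'dx \<Rightarrow> real ^ 'dz \<Rightarrow> real) \<Rightarrow> ennreal" where
  "L1_loss f q' q =
     (\<integral>\<^sup>+ z. (\<integral>\<^sup>+ x. ennreal (\<bar>q' x z - q x z\<bar> * f z) \<partial>cube_lebesgue) \<partial>cube_lebesgue)"

definition L1_risk ::
    "nat \<Rightarrow> (real ^ 'dz \<Rightarrow> real) \<Rightarrow> ((real ^ 'dx) \<times> (real ^ 'dz)) measure \<Rightarrow>
     (real ^ 'dx \<Rightarrow> real ^ 'dz \<Rightarrow> real) \<Rightarrow>
     ((nat \<Rightarrow> (real ^ 'dx) \<times> (real ^ 'dz)) \<Rightarrow> real ^ 'dx \<Rightarrow> real ^ 'dz \<Rightarrow> real) \<Rightarrow> ennreal" where
  "L1_risk n f P q p_hat = (\<integral>\<^sup>+ D. L1_loss f (p_hat D) q \<partial>PiM {..<n} (\<lambda>_. P))"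

definition kappa :: "nat \<Rightarrow> real \<Rightarrow> real \<Rightarrow> real" where
  "kappa d \<beta> W =
     (if \<beta> \<le> 1 \<and> W < 2 / real d powr \<beta>
      then W\<^sup>2 * real d powr (2 * \<beta> - 1) / 144
      else 1 / (36 * real d))"

end

theory Submission
  imports Defs
begin

text \<open>
  The difficulty of estimating a conditional density without smoothness in \<open>z\<close> is that the data
  say nothing about \<open>p\<^bsub>X|Z\<^esub>(\<cdot>|z)\<close> for the values \<open>z\<close> that were not observed.  Cut the
  \<open>z\<close>-cube into finitely many cells of \<open>p\<^sub>Z\<close>-mass at most \<open>\<delta> = \<epsilon>/n\<close>, fix a function \<open>g\<close> on the
  \<open>x\<close>-cube with \<open>\<integral>g = 0\<close> and \<open>\<bar>g\<bar> \<le> 1\<close>, and choose a sign for each cell.  The conditional densities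
  \<open>1 \<plusminus> g(x)\<close>, with the sign of the cell that contains \<open>z\<close>, form the finite class.

  A given cell contains no observation with probability at least \<open>(1 - \<delta>)\<^sup>n \<ge> 1 - n\<delta>\<close>.  On that event
  the two laws that differ only in the sign on this cell assign the same probabilities to the data
  (\<open>two_point_bound\<close>), while every guess is on average at \<open>L\<^sup>1\<close> distance at least \<open>\<integral>\<bar>g\<bar>\<close> from the two
  candidates \<open>1 + g\<close> and \<open>1 - g\<close> (\<open>strip_loss_separation\<close>); in the loss, this distance is weighted
  with the mass of the cell.  Averaging over all sign patterns, as in
  Assouad's lemma (\<open>assouad\<close>), and summing over the cells, whose masses add up to one, some member of
  the class has risk at least \<open>(1 - n\<delta>) \<integral>\<bar>g\<bar> \<ge> \<integral>\<bar>g\<bar> - \<epsilon>\<close>.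

  It remains to choose \<open>g\<close>.  A linear function \<open>g(x) = c (x\<^sub>i - 1/2)\<close> of one coordinate is
  good enough: it is Hoelder with constant \<open>c\<close> if \<open>\<beta> \<le> 1\<close>, and if \<open>\<beta> > 1\<close> its derivatives of order
  \<open>\<lfloor>\<beta>\<rfloor> \<ge> 1\<close> (the largest integer strictly below \<open>\<beta>\<close>) are constant, so that \<open>c\<close> is restricted only by \<open>\<bar>g\<bar> \<le> 1\<close>, that is \<open>c \<le> 2\<close>.  Since
  \<open>\<integral>\<bar>g\<bar> \<ge> c/6\<close>, the constant \<open>\<kappa>\<close> is reached in each case (\<open>kappa_le_slope\<close>).
\<close>

section \<open>The cube and its uniform distribution\<close>

lemma space_cube_lebesgue [simp]: "space cube_lebesgue = unit_cube"
  by (simp add: cube_lebesgue_def space_restrict_space)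

lemma unit_cube_eq_cbox: "unit_cube = cbox (0 :: real ^ 'n) 1"
  by (auto simp: unit_cube_def mem_box_cart)

lemma unit_cube_borel [measurable]: "unit_cube \<in> sets (borel :: (real ^ 'n) measure)"
  by (simp add: unit_cube_eq_cbox)

lemma measurable_cube_coordinate [measurable]:
  "(\<lambda>x. x $ i) \<in> borel_measurable cube_lebesgue"
  by (simp add: cube_lebesgue_def measurable_restrict_space1)

text \<open>
  The uniform distribution on the cube has uniform marginals: the integral is a product over the
  coordinates, in which all factors but one equal \<open>1\<close>.  Both the mass of the profile and the nullity
  of the hyperplanes that bound the cells are computed in this way.
\<close>

lemma nn_integral_cube_coordinate:
  fixes i :: "'n::finite" and h :: "real \<Rightarrow> ennreal"
  assumes [measurable]: "h \<in> borel_measurable borel"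
  shows "(\<integral>\<^sup>+ x. h (x $ i) \<partial>(cube_lebesgue :: (real ^ 'n) measure))
         = (\<integral>\<^sup>+ t. h t * indicator {0..1} t \<partial>lborel)"
proof -
  let ?e = "axis i 1 :: real ^ 'n"
  define F where "F = (\<lambda>b :: real ^ 'n. \<lambda>t. (if b = ?e then h t else 1) * indicator {0..1 :: real} t)"
  have [measurable]: "F b \<in> borel_measurable borel" for b
    unfolding F_def by (cases "b = ?e") auto
  have e: "?e \<in> Basis" by simp
  have split: "prod G Basis = G ?e * prod G (Basis - {?e})" for G :: "real ^ 'n \<Rightarrow> ennreal"
    using e by (simp add: prod.remove)
  have ind: "(\<Prod>b\<in>Basis. indicator {0..1} (x \<bullet> b)) = (indicator unit_cube x :: ennreal)"
    for x :: "real ^ 'n"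
  proof (cases "x \<in> unit_cube")
    case True
    then show ?thesis
      by (auto simp: unit_cube_def Basis_vec_def inner_axis intro!: prod.neutral)
  next
    case False
    then obtain b :: "real ^ 'n" where "b \<in> Basis" "x \<bullet> b \<notin> {0..1}"
      by (auto simp: unit_cube_def Basis_vec_def cart_eq_inner_axis)
    with False show ?thesis by (auto intro!: prod_zero bexI[of _ b])
  qed
  have "(\<integral>\<^sup>+ x. h (x $ i) \<partial>cube_lebesgue)
      = (\<integral>\<^sup>+ x. h (x $ i) * indicator unit_cube x \<partial>lborel)"
    by (simp add: cube_lebesgue_def nn_integral_restrict_space)
  also have "\<dots> = (\<integral>\<^sup>+ x. (\<Prod>b\<in>Basis. F b (x \<bullet> b)) \<partial>lborel)"
    by (intro nn_integral_cong)
       (simp add: F_def prod.distrib ind prod.If_cases split cart_eq_inner_axis)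
  also have "\<dots> = (\<Prod>b\<in>Basis. \<integral>\<^sup>+ t. F b t \<partial>lborel)"
    by (rule nn_integral_lborel_prod) auto
  also have "\<dots> = (\<integral>\<^sup>+ t. h t * indicator {0..1} t \<partial>lborel)"
    unfolding split by (simp add: F_def)
  finally show ?thesis .
qed

lemma prob_space_cube_lebesgue: "prob_space (cube_lebesgue :: (real ^ 'n) measure)"
proof
  show "emeasure (cube_lebesgue :: (real ^ 'n) measure) (space cube_lebesgue) = 1"
    using nn_integral_cube_coordinate[of "\<lambda>_. 1" "undefined :: 'n"] by simp
qed

abbreviation joint_cube where
  "joint_cube \<equiv> cube_lebesgue \<Otimes>\<^sub>M cube_lebesgue"

interpretation cube: prob_space "cube_lebesgue :: (real ^ 'n) measure"
  by (rule prob_space_cube_lebesgue)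

interpretation joint_cube: pair_prob_space
  "cube_lebesgue :: (real ^ 'dx) measure" "cube_lebesgue :: (real ^ 'dz) measure" ..

section \<open>Joint laws with given marginal and conditional densities\<close>

definition joint_law ::
    "(real ^ 'dz \<Rightarrow> real) \<Rightarrow> (real ^ 'dx \<Rightarrow> real ^ 'dz \<Rightarrow> real) \<Rightarrow>
     ((real ^ 'dx) \<times> (real ^ 'dz)) measure" where
  "joint_law f q = density joint_cube (\<lambda>(x, z). ennreal (q x z * f z))"

text \<open>
  Integrating \<open>q x z\<close> over \<open>x\<close> first leaves \<open>f z\<close>.  This gives the marginal law of \<open>Z\<close> as well as the
  probability that an observation avoids a cell.
\<close>

lemma emeasure_joint_law_strip:
  fixes q :: "real ^ 'dx \<Rightarrow> real ^ 'dz \<Rightarrow> real"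
  assumes f: "is_cube_density f"
    and [measurable]: "(\<lambda>(x, z). q x z) \<in> borel_measurable joint_cube"
    and q: "\<And>z. z \<in> unit_cube \<Longrightarrow> is_cube_density (\<lambda>x. q x z)"
    and [measurable]: "A \<in> sets cube_lebesgue"
  shows "emeasure (joint_law f q) (unit_cube \<times> A) = emeasure (density cube_lebesgue f) A"
proof -
  have [measurable]: "f \<in> borel_measurable cube_lebesgue"
    using f by (simp add: is_cube_density_def)
  have "emeasure (joint_law f q) (unit_cube \<times> A)
      = (\<integral>\<^sup>+ (x, z). ennreal (q x z * f z) * indicator A z \<partial>joint_cube)"
    unfolding joint_law_def using sets.top[of "cube_lebesgue"]
    by (subst emeasure_density)
       (auto intro!: nn_integral_cong simp: space_pair_measure indicator_def)
  also have "\<dots> = (\<integral>\<^sup>+ z. (\<integral>\<^sup>+ x. ennreal (q x z * f z) * indicator A z \<partial>cube_lebesgue) \<partial>cube_lebesgue)"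
    by (subst joint_cube.nn_integral_snd[symmetric]) (auto simp: split_beta')
  also have "\<dots> = (\<integral>\<^sup>+ z. ennreal (f z) * indicator A z \<partial>cube_lebesgue)"
  proof (intro nn_integral_cong)
    fix z :: "real ^ 'dz" assume "z \<in> space cube_lebesgue"
    then have z: "z \<in> unit_cube" by simp
    have [measurable]: "(\<lambda>x. q x z) \<in> borel_measurable cube_lebesgue"
      using q[OF z] by (simp add: is_cube_density_def)
    have "(\<integral>\<^sup>+ x. ennreal (q x z * f z) * indicator A z \<partial>cube_lebesgue)
        = (\<integral>\<^sup>+ x. ennreal (q x z) * (ennreal (f z) * indicator A z) \<partial>cube_lebesgue)"
      using q[OF z] f z
      by (intro nn_integral_cong) (simp add: is_cube_density_def ennreal_mult' mult.assoc)
    also have "\<dots> = ennreal (f z) * indicator A z"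
      using q[OF z] by (subst nn_integral_multc) (auto simp: is_cube_density_def)
    finally show "(\<integral>\<^sup>+ x. ennreal (q x z * f z) * indicator A z \<partial>cube_lebesgue) = ennreal (f z) * indicator A z" .
  qed
  also have "\<dots> = emeasure (density cube_lebesgue f) A"
    by (subst emeasure_density) auto
  finally show ?thesis .
qed

lemma prob_space_cube_density:
  assumes "is_cube_density f"
  shows "prob_space (density cube_lebesgue (\<lambda>z. ennreal (f z)))"
proof (rule prob_spaceI)
  have "emeasure (density cube_lebesgue (\<lambda>z. ennreal (f z))) (space cube_lebesgue)
      = (\<integral>\<^sup>+ z. ennreal (f z) \<partial>cube_lebesgue)"
    using assms by (subst emeasure_density) (auto simp: is_cube_density_def
        intro!: nn_integral_cong simp del: space_cube_lebesgue)
  then show "emeasure (density cube_lebesgue (\<lambda>z. ennreal (f z)))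
      (space (density cube_lebesgue (\<lambda>z. ennreal (f z)))) = 1"
    using assms by (simp add: is_cube_density_def)
qed

lemma joint_law_properties:
  fixes q :: "real ^ 'dx \<Rightarrow> real ^ 'dz \<Rightarrow> real"
  assumes f: "is_cube_density f"
    and [measurable]: "(\<lambda>(x, z). q x z) \<in> borel_measurable joint_cube"
    and q: "\<And>z. z \<in> unit_cube \<Longrightarrow> is_cube_density (\<lambda>x. q x z)"
  shows "ac_distribution (joint_law f q)"
    and "has_Z_marginal_density (joint_law f q) f"
    and "is_conditional_density (joint_law f q) f q"
proof -
  have [measurable]: "f \<in> borel_measurable cube_lebesgue"
    using f by (simp add: is_cube_density_def)
  have sets: "sets (joint_law f q) = sets joint_cube" by (simp add: joint_law_def)
  have space: "space (joint_law f q) = unit_cube \<times> unit_cube"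
    by (simp add: joint_law_def space_pair_measure)
  have meas: "snd \<in> measurable (joint_law f q) cube_lebesgue"
    using sets by (simp cong: measurable_cong_sets)
  show marginal: "has_Z_marginal_density (joint_law f q) f"
    unfolding has_Z_marginal_density_def
  proof (rule measure_eqI)
    fix A assume "A \<in> sets (distr (joint_law f q) cube_lebesgue snd)"
    then have A: "A \<in> sets cube_lebesgue" by simp
    then have "snd -` A \<inter> space (joint_law f q) = unit_cube \<times> A"
      using sets.sets_into_space[OF A] space by auto
    with A show "emeasure (distr (joint_law f q) cube_lebesgue snd) A
        = emeasure (density cube_lebesgue (\<lambda>z. ennreal (f z))) A"
      using emeasure_joint_law_strip[OF f assms(2) q A] meas by (simp add: emeasure_distr)
  qed simp
  have "prob_space (joint_law f q)"
    using prob_space_cube_density[OF f] marginal meas by (intro prob_space_distrD[of snd _ cube_lebesgue])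
      (simp_all add: has_Z_marginal_density_def)
  moreover have "absolutely_continuous joint_cube (joint_law f q)"
    unfolding joint_law_def by (rule absolutely_continuousI_density) measurable
  ultimately show "ac_distribution (joint_law f q)"
    using sets by (simp add: ac_distribution_def)
  show "is_conditional_density (joint_law f q) f q"
    using assms by (simp add: is_conditional_density_def joint_law_def)
qed

section \<open>The loss\<close>

text \<open>
  The part of the loss that is due to \<open>z \<in> A\<close>.  It is a single integral over the product, in which
  measurability and sums over several sets \<open>A\<close> are easier to handle than in an iterated one.
\<close>

definition strip_loss ::
    "(real ^ 'dz \<Rightarrow> real) \<Rightarrow> (real ^ 'dx \<Rightarrow> real ^ 'dz \<Rightarrow> real) \<Rightarrow>
     (real ^ 'dx \<Rightarrow> real ^ 'dz \<Rightarrow> real) \<Rightarrow> (real ^ 'dz) set \<Rightarrow> ennreal" where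
  "strip_loss f q' q A =
     (\<integral>\<^sup>+ (x, z). ennreal (\<bar>q' x z - q x z\<bar> * f z) * indicator A z \<partial>joint_cube)"

lemma L1_loss_eq_strip_loss:
  assumes [measurable]: "f \<in> borel_measurable cube_lebesgue"
    "(\<lambda>(x, z). q x z) \<in> borel_measurable joint_cube"
    "(\<lambda>(x, z). q' x z) \<in> borel_measurable joint_cube"
  shows "L1_loss f q' q = strip_loss f q' q UNIV"
  unfolding L1_loss_def strip_loss_def
  by (subst joint_cube.nn_integral_snd[symmetric]) (auto simp: split_beta')

lemma strip_loss_partition:
  fixes k :: "real ^ 'dz \<Rightarrow> 'j" and q :: "real ^ 'dx \<Rightarrow> real ^ 'dz \<Rightarrow> real"
  assumes [measurable]: "f \<in> borel_measurable cube_lebesgue"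
    "(\<lambda>(x, z). q x z) \<in> borel_measurable joint_cube"
    "(\<lambda>(x, z). q' x z) \<in> borel_measurable joint_cube"
    "k \<in> measurable cube_lebesgue (count_space UNIV)"
    and J: "finite J" "\<And>z. z \<in> unit_cube \<Longrightarrow> k z \<in> J"
  shows "strip_loss f q' q UNIV = (\<Sum>j\<in>J. strip_loss f q' q {z \<in> unit_cube. k z = j})"
proof -
  have [measurable]: "{z \<in> unit_cube. k z = j} \<in> sets cube_lebesgue" for j
    unfolding space_cube_lebesgue[symmetric] by measurable
  have "strip_loss f q' q UNIV
      = (\<integral>\<^sup>+ (x, z). (\<Sum>j\<in>J. ennreal (\<bar>q' x z - q x z\<bar> * f z) * indicator {z \<in> unit_cube. k z = j} z) \<partial>joint_cube)"
    unfolding strip_loss_def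
  proof (intro nn_integral_cong, clarsimp simp: space_pair_measure)
    fix x :: "real ^ 'dx" and z :: "real ^ 'dz" assume z: "z \<in> unit_cube"
    then have "indicator {z \<in> unit_cube. k z = j} z = (if j = k z then 1 else 0 :: ennreal)" for j
      by (auto simp: indicator_def)
    then show "ennreal (\<bar>q' x z - q x z\<bar> * f z)
        = (\<Sum>j\<in>J. ennreal (\<bar>q' x z - q x z\<bar> * f z) * indicator {z \<in> unit_cube. k z = j} z)"
      using J z by (simp add: mult_delta_right)
  qed
  also have "\<dots> = (\<Sum>j\<in>J. strip_loss f q' q {z \<in> unit_cube. k z = j})"
    unfolding strip_loss_def by (subst nn_integral_sum[symmetric]) (auto simp: split_beta')
  finally show ?thesis .
qed

text \<open>
  Two versions of the conditional density differ only on a null set of \<open>f(z) dx dz\<close>.  Since distinct sign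
  patterns may induce the same law (they do if they differ on a cell of mass zero), a law does not
  determine its pattern; by this lemma the choice does not affect the risk.
\<close>

lemma L1_loss_conditional_density_unique:
  assumes f: "is_cube_density f"
    and q1: "is_conditional_density P f q1" and q2: "is_conditional_density P f q2"
    and [measurable]: "(\<lambda>(x, z). q' x z) \<in> borel_measurable joint_cube"
  shows "L1_loss f q' q1 = L1_loss f q' q2"
proof -
  have [measurable]: "f \<in> borel_measurable cube_lebesgue"
    using f by (simp add: is_cube_density_def)
  have [measurable]: "(\<lambda>(x, z). q1 x z) \<in> borel_measurable joint_cube"
      "(\<lambda>(x, z). q2 x z) \<in> borel_measurable joint_cube"
    using q1 q2 by (simp_all add: is_conditional_density_def)
  have "density joint_cube (\<lambda>(x, z). ennreal (q1 x z * f z))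
      = density joint_cube (\<lambda>(x, z). ennreal (q2 x z * f z))"
    using q1 q2 by (simp add: is_conditional_density_def)
  then have ae: "AE (x, z) in joint_cube. ennreal (q1 x z * f z) = ennreal (q2 x z * f z)"
    by (subst (asm) joint_cube.density_unique_iff) (auto simp: split_beta')
  have "strip_loss f q' q1 UNIV = strip_loss f q' q2 UNIV"
    unfolding strip_loss_def
  proof (rule nn_integral_cong_AE, use ae AE_space in eventually_elim, safe)
    fix x :: "real ^ 'b" and z :: "real ^ 'a"
    assume xz: "(x, z) \<in> space joint_cube"
      and eq: "ennreal (q1 x z * f z) = ennreal (q2 x z * f z)"
    have x: "x \<in> unit_cube" "z \<in> unit_cube" using xz by (auto simp: space_pair_measure)
    then have "0 \<le> f z" "0 \<le> q1 x z" "0 \<le> q2 x z"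
      using f q1 q2 by (auto simp: is_conditional_density_def is_cube_density_def)
    with eq have "q1 x z * f z = q2 x z * f z" by simp
    then have "\<bar>q' x z - q1 x z\<bar> * f z = \<bar>q' x z - q2 x z\<bar> * f z"
      by (cases "f z = 0") auto
    then show "ennreal (\<bar>q' x z - q1 x z\<bar> * f z) * indicator UNIV z
        = ennreal (\<bar>q' x z - q2 x z\<bar> * f z) * indicator UNIV z" by (simp only:)
  qed
  then show ?thesis by (simp add: L1_loss_eq_strip_loss)
qed

lemma estimator_section_measurable:
  assumes "p_hat \<in> estimators n" "D \<in> space (PiM {..<n} (\<lambda>_. joint_cube))"
  shows "(\<lambda>(x, z). p_hat D x z) \<in> borel_measurable joint_cube"
  using measurable_compose[OF measurable_Pair1'[OF assms(2)], of _ joint_cube borel] assms(1)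
  by (fastforce simp: estimators_def split_beta')

lemma strip_loss_measurable:
  fixes q :: "real ^ 'dx \<Rightarrow> real ^ 'dz \<Rightarrow> real"
  assumes [measurable]: "f \<in> borel_measurable cube_lebesgue"
    "(\<lambda>(x, z). q x z) \<in> borel_measurable joint_cube" "A \<in> sets cube_lebesgue"
    and p: "p_hat \<in> estimators n"
  shows "(\<lambda>D. strip_loss f (p_hat D) q A) \<in> borel_measurable (PiM {..<n} (\<lambda>_. joint_cube))"
proof -
  let ?M = "PiM {..<n} (\<lambda>_. joint_cube) \<Otimes>\<^sub>M joint_cube"
  have [measurable]: "(\<lambda>w. p_hat (fst w) (fst (snd w)) (snd (snd w))) \<in> borel_measurable ?M"
    using p by (simp add: estimators_def split_beta')
  have [measurable]: "(\<lambda>w. q (fst (snd w)) (snd (snd w))) \<in> borel_measurable ?M"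
    using measurable_compose[OF measurable_snd assms(2)] by (simp add: split_beta')
  show ?thesis unfolding strip_loss_def
    by (rule joint_cube.borel_measurable_nn_integral) (simp add: split_beta')
qed

section \<open>Samples that cannot tell two laws apart\<close>

text \<open>
  The two sides are measures on the product space that agree on every box \<open>\<Pi> A\<^sub>i\<close>: both give it the
  product of the common values on the sets \<open>A\<^sub>i \<inter> B\<close>.
\<close>

lemma PiM_agree_on_box:
  fixes P Q :: "'a measure" and n :: nat
  assumes "prob_space P" "prob_space Q" and sets: "sets Q = sets P"
    and B: "B \<in> sets P" and agree: "\<And>A. A \<in> sets P \<Longrightarrow> A \<subseteq> B \<Longrightarrow> emeasure P A = emeasure Q A"
  shows "density (PiM {..<n} (\<lambda>_. P)) (indicator ({..<n} \<rightarrow>\<^sub>E B))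
       = density (PiM {..<n} (\<lambda>_. Q)) (indicator ({..<n} \<rightarrow>\<^sub>E B))"
proof -
  interpret P: prob_space P by fact
  interpret Q: prob_space Q by fact
  interpret PP: product_prob_space "\<lambda>_ :: nat. P" ..
  interpret QQ: product_prob_space "\<lambda>_ :: nat. Q" ..
  let ?B = "{..<n} \<rightarrow>\<^sub>E B"
  let ?P = "PiM {..<n} (\<lambda>_. P)" and ?Q = "PiM {..<n} (\<lambda>_. Q)"
  have sets_Pi: "sets ?Q = sets ?P" by (intro sets_PiM_cong) (auto simp: sets)
  have box: "(\<Pi>\<^sub>E i\<in>{..<n}. A i) \<in> sets ?P" if "\<And>i. i < n \<Longrightarrow> A i \<in> sets P" for A
    by (rule sets_PiM_I_finite) (use that in auto)
  note boxB = box[of "\<lambda>_. B", OF B]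
  have eval: "emeasure (density (PiM {..<n} (\<lambda>_. R)) (indicator ?B)) X
      = emeasure (PiM {..<n} (\<lambda>_. R)) (?B \<inter> X)" if "R = P \<or> R = Q" "X \<in> sets ?P" for R X
  proof -
    have "?B \<in> sets (PiM {..<n} (\<lambda>_. R))" "X \<in> sets (PiM {..<n} (\<lambda>_. R))"
      using that boxB sets_Pi by auto
    then show ?thesis
      by (simp add: emeasure_density flip: indicator_inter_arith)
  qed
  show ?thesis
  proof (rule measure_eqI_PiM_finite[where I = "{..<n}" and M = "\<lambda>_. P"
        and A = "\<lambda>_. {..<n} \<rightarrow>\<^sub>E space P"])
    fix A :: "nat \<Rightarrow> 'a set" assume A: "\<And>i. i \<in> {..<n} \<Longrightarrow> A i \<in> sets P"
    then have AB: "A i \<inter> B \<in> sets P" if "i < n" for i using that B by auto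
    have "(\<Prod>i<n. emeasure P (A i \<inter> B)) = (\<Prod>i<n. emeasure Q (A i \<inter> B))"
      using AB by (intro prod.cong agree) auto
    moreover have "emeasure ?P (?B \<inter> Pi\<^sub>E {..<n} A) = (\<Prod>i<n. emeasure P (A i \<inter> B))"
      "emeasure ?Q (?B \<inter> Pi\<^sub>E {..<n} A) = (\<Prod>i<n. emeasure Q (A i \<inter> B))"
      using AB sets PP.emeasure_PiM[of "{..<n}" "\<lambda>i. A i \<inter> B"]
        QQ.emeasure_PiM[of "{..<n}" "\<lambda>i. A i \<inter> B"]
      by (simp_all add: PiE_Int Int_commute[of B])
    ultimately show "emeasure (density ?P (indicator ?B)) (Pi\<^sub>E {..<n} A)
        = emeasure (density ?Q (indicator ?B)) (Pi\<^sub>E {..<n} A)"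
      using box A by (simp add: eval)
  next
    show "range (\<lambda>_ :: nat. {..<n} \<rightarrow>\<^sub>E space P) \<subseteq> prod_algebra {..<n} (\<lambda>_. P)"
      by (auto intro!: prod_algebraI_finite)
    have "emeasure ?P (?B \<inter> ({..<n} \<rightarrow>\<^sub>E space P)) \<le> emeasure ?P (space ?P)"
      by (intro emeasure_mono) (auto simp: space_PiM)
    also have "\<dots> < \<infinity>"
      using prob_space.emeasure_space_1[OF prob_space_PiM[of "{..<n}" "\<lambda>_. P"]] P.prob_space_axioms by simp
    finally show "emeasure (density ?P (indicator ?B)) ({..<n} \<rightarrow>\<^sub>E space P) \<noteq> \<infinity>"
      using box[of "\<lambda>_. space P"] by (simp add: eval)
  qed (auto simp: sets_Pi space_PiM)
qed

text \<open>
  Le Cam's two-point argument in its most elementary form.  If \<open>P\<close> and \<open>Q\<close> can only be told apart by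
  an observation outside \<open>B\<close>, then on the event that the whole sample lies in \<open>B\<close> the second
  integral may be taken with respect to \<open>P\<close> too, so the sum of the integrals is at least \<open>c\<close> times the
  probability \<open>P(B)\<^sup>n \<ge> 1 - n(1 - P(B)) \<ge> 1 - n\<delta>\<close> of that event.
\<close>

lemma two_point_bound:
  fixes P Q :: "'a measure" and n :: nat
  assumes P: "prob_space P" and Q: "prob_space Q" and sets: "sets Q = sets P"
    and B: "B \<in> sets P" and agree: "\<And>A. A \<in> sets P \<Longrightarrow> A \<subseteq> B \<Longrightarrow> emeasure P A = emeasure Q A"
    and likely: "1 - \<delta> \<le> measure P B"
    and F [measurable]: "F \<in> borel_measurable (PiM {..<n} (\<lambda>_. P))"
    and G [measurable]: "G \<in> borel_measurable (PiM {..<n} (\<lambda>_. P))"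
    and FG: "\<And>D. D \<in> space (PiM {..<n} (\<lambda>_. P)) \<Longrightarrow> c \<le> F D + G D"
  shows "ennreal (1 - real n * \<delta>) * c
      \<le> (\<integral>\<^sup>+ D. F D \<partial>PiM {..<n} (\<lambda>_. P)) + (\<integral>\<^sup>+ D. G D \<partial>PiM {..<n} (\<lambda>_. Q))"
proof -
  interpret P: prob_space P by fact
  interpret Q: prob_space Q by fact
  interpret PP: product_prob_space "\<lambda>_ :: nat. P" ..
  let ?B = "{..<n} \<rightarrow>\<^sub>E B"
  let ?P = "PiM {..<n} (\<lambda>_. P)" and ?Q = "PiM {..<n} (\<lambda>_. Q)"
  have sets_Pi [measurable_cong]: "sets ?Q = sets ?P" by (intro sets_PiM_cong) (auto simp: sets)
  have box [measurable]: "?B \<in> sets ?P"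
    by (rule sets_PiM_I_finite) (use B in auto)
  have "1 - real n * \<delta> \<le> 1 + real n * (measure P B - 1)"
    using mult_left_mono[of "1 - measure P B" \<delta> "real n"] likely by (simp add: algebra_simps)
  also have "\<dots> \<le> (1 + (measure P B - 1)) ^ n"
    by (rule Bernoulli_inequality) simp
  finally have "ennreal (1 - real n * \<delta>) \<le> ennreal (measure P B ^ n)"
    by (intro ennreal_leI) simp
  also have "\<dots> = emeasure ?P ?B"
    using B by (simp add: PP.emeasure_PiM P.emeasure_eq_measure ennreal_power)
  finally have "ennreal (1 - real n * \<delta>) * c \<le> emeasure ?P ?B * c"
    by (rule mult_right_mono) simp
  also have "\<dots> = (\<integral>\<^sup>+ D. c * indicator ?B D \<partial>?P)"
    using box by (simp add: nn_integral_cmult_indicator mult.commute)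
  also have "\<dots> \<le> (\<integral>\<^sup>+ D. indicator ?B D * F D + indicator ?B D * G D \<partial>?P)"
    using FG by (intro nn_integral_mono) (auto simp: indicator_def)
  also have "\<dots> = (\<integral>\<^sup>+ D. indicator ?B D * F D \<partial>?P) + (\<integral>\<^sup>+ D. indicator ?B D * G D \<partial>?P)"
    by (rule nn_integral_add) measurable
  also have "(\<integral>\<^sup>+ D. indicator ?B D * G D \<partial>?P) = (\<integral>\<^sup>+ D. G D \<partial>density ?P (indicator ?B))"
    by (rule nn_integral_density[symmetric]) measurable
  also have "\<dots> = (\<integral>\<^sup>+ D. G D \<partial>density ?Q (indicator ?B))"
    using PiM_agree_on_box[OF P Q sets B agree, of n] by simp
  also have "\<dots> = (\<integral>\<^sup>+ D. indicator ?B D * G D \<partial>?Q)"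
    by (rule nn_integral_density) measurable
  also have "\<dots> \<le> (\<integral>\<^sup>+ D. G D \<partial>?Q)"
    by (intro nn_integral_mono) (auto simp: indicator_def)
  also have "(\<integral>\<^sup>+ D. indicator ?B D * F D \<partial>?P) \<le> (\<integral>\<^sup>+ D. F D \<partial>?P)"
    by (intro nn_integral_mono) (auto simp: indicator_def)
  finally show ?thesis by (simp add: add_mono)
qed

text \<open>
  Pairs each sign pattern with the one that differs from it exactly at \<open>j\<close>.
\<close>

lemma sum_Pow_pair:
  fixes a :: "'j set \<Rightarrow> ennreal"
  assumes "finite J" "j \<in> J"
  shows "(\<Sum>S\<in>Pow J. a S) = (\<Sum>S\<in>Pow (J - {j}). a S + a (insert j S))"
proof -
  have "Pow J = Pow (J - {j}) \<union> insert j ` Pow (J - {j})"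
    using Pow_insert[of j "J - {j}"] assms by (simp add: insert_absorb)
  moreover have "inj_on (insert j) (Pow (J - {j}))"
    by (auto simp: inj_on_def)
  ultimately show ?thesis
    using assms by (simp add: sum.union_disjoint sum.reindex sum.distrib disjoint_iff)
      (subst sum.union_disjoint; auto simp: sum.reindex)
qed

text \<open>
  Assouad's lemma.  The patterns \<open>S \<subseteq> J\<close> are the vertices of a hypercube of laws, and \<open>B j\<close> is the
  event that an observation is uninformative about \<open>j\<close>.  Flipping \<open>j\<close> pairs up the
  \<open>2\<^bsup>card J\<^esup>\<close> vertices, and the two-point bound on each pair shows that the \<open>j\<close>-th loss, averaged
  over all vertices, is at least \<open>(1 - n\<delta>) c j\<close>.  The worst vertex is at least as bad as the average.
\<close>

lemma assouad:
  fixes P :: "'j set \<Rightarrow> 'a measure" and L :: "'j \<Rightarrow> 'j set \<Rightarrow> (nat \<Rightarrow> 'a) \<Rightarrow> ennreal"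
  assumes J: "finite J"
    and prob: "\<And>S. prob_space (P S)" and sets: "\<And>S. sets (P S) = sets M"
    and B: "\<And>j. B j \<in> sets M"
    and agree: "\<And>j S A. A \<in> sets M \<Longrightarrow> A \<subseteq> B j \<Longrightarrow> emeasure (P S) A = emeasure (P (insert j S)) A"
    and likely: "\<And>j S. 1 - \<delta> \<le> measure (P S) (B j)"
    and L: "\<And>j S. L j S \<in> borel_measurable (PiM {..<n} (\<lambda>_. M))"
    and sep: "\<And>j S D. j \<in> J \<Longrightarrow> j \<notin> S \<Longrightarrow> D \<in> space (PiM {..<n} (\<lambda>_. M)) \<Longrightarrow>
                2 * c j \<le> L j S D + L j (insert j S) D"
  shows "\<exists>S\<subseteq>J. ennreal (1 - real n * \<delta>) * (\<Sum>j\<in>J. c j)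
            \<le> (\<integral>\<^sup>+ D. (\<Sum>j\<in>J. L j S D) \<partial>PiM {..<n} (\<lambda>_. P S))"
proof -
  let ?R = "\<lambda>S. (\<integral>\<^sup>+ D. (\<Sum>j\<in>J. L j S D) \<partial>PiM {..<n} (\<lambda>_. P S))"
  let ?r = "\<lambda>j S. (\<integral>\<^sup>+ D. L j S D \<partial>PiM {..<n} (\<lambda>_. P S))"
  let ?p = "ennreal (1 - real n * \<delta>)"
  have sets_Pi: "sets (PiM {..<n} (\<lambda>_. P S)) = sets (PiM {..<n} (\<lambda>_. M))" for S
    by (intro sets_PiM_cong) (auto simp: sets)
  have L' [measurable]: "L j T \<in> borel_measurable (PiM {..<n} (\<lambda>_. P S))" for j T S
    using L sets_Pi by (simp cong: measurable_cong_sets)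
  have pair: "?p * (2 * c j) \<le> ?r j S + ?r j (insert j S)" if "j \<in> J" "j \<notin> S" for j S
  proof (rule two_point_bound[OF prob prob _ _ _ likely L' L'])
    fix A assume "A \<in> sets (P S)" "A \<subseteq> B j"
    then show "emeasure (P S) A = emeasure (P (insert j S)) A"
      by (intro agree) (simp_all add: sets)
  next
    fix D assume "D \<in> space (PiM {..<n} (\<lambda>_. P S))"
    then have "D \<in> space (PiM {..<n} (\<lambda>_. M))"
      using sets_eq_imp_space_eq[OF sets_Pi[of S]] by simp
    then show "2 * c j \<le> L j S D + L j (insert j S) D" by (rule sep[OF that])
  qed (simp_all add: sets B)
  have cell: "2 ^ card J * (?p * c j) \<le> (\<Sum>S\<in>Pow J. ?r j S)" if j: "j \<in> J" for j
  proof -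
    have "card J = Suc (card (J - {j}))" using card.remove[OF J j] .
    then have "2 ^ card J * (?p * c j) = (\<Sum>S\<in>Pow (J - {j}). ?p * (2 * c j))"
      using J by (simp add: card_Pow mult_ac)
    also have "\<dots> \<le> (\<Sum>S\<in>Pow (J - {j}). ?r j S + ?r j (insert j S))"
      using j by (intro sum_mono pair) auto
    also have "\<dots> = (\<Sum>S\<in>Pow J. ?r j S)" using sum_Pow_pair[OF J j] by simp
    finally show ?thesis .
  qed
  define m where "m = Max (?R ` Pow J)"
  have "m \<in> ?R ` Pow J" unfolding m_def using J by (intro Max_in) auto
  then obtain S where S: "S \<subseteq> J" "m = ?R S" by auto
  have "2 ^ card J * (?p * (\<Sum>j\<in>J. c j)) = (\<Sum>j\<in>J. 2 ^ card J * (?p * c j))"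
    by (simp add: sum_distrib_left)
  also have "\<dots> \<le> (\<Sum>j\<in>J. \<Sum>S\<in>Pow J. ?r j S)" by (intro sum_mono cell)
  also have "\<dots> = (\<Sum>S\<in>Pow J. \<Sum>j\<in>J. ?r j S)" by (rule sum.swap)
  also have "\<dots> = (\<Sum>S\<in>Pow J. ?R S)" by (intro sum.cong nn_integral_sum[symmetric]) auto
  also have "\<dots> \<le> of_nat (card (Pow J)) * m"
    using J by (intro sum_bounded_above) (auto simp: m_def)
  also have "\<dots> = 2 ^ card J * m" using J by (simp add: card_Pow)
  finally have "?p * (\<Sum>j\<in>J. c j) \<le> m"
    by (subst (asm) ennreal_mult_le_mult_iff) (simp_all add: power_eq_top_ennreal)
  with S show ?thesis by auto
qed

section \<open>Cells of small mass\<close>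

text \<open>
  An absolutely continuous law gives no mass to a hyperplane, so the distribution function of
  one coordinate of \<open>Z\<close> is continuous, hence uniformly continuous on a compact interval.
  Slabs orthogonal to that coordinate and of small enough width \<open>1/N\<close> thus all have mass at most \<open>\<delta>\<close>.
\<close>

lemma small_cells:
  fixes f :: "real ^ 'n \<Rightarrow> real"
  assumes f: "is_cube_density f" and "\<delta> > 0"
  obtains k :: "real ^ 'n \<Rightarrow> nat" and N :: nat
  where "k \<in> measurable cube_lebesgue (count_space UNIV)"
    and "\<And>z. z \<in> unit_cube \<Longrightarrow> k z \<le> N"
    and "\<And>j. emeasure (density cube_lebesgue (\<lambda>z. ennreal (f z))) {z \<in> unit_cube. k z = j} \<le> ennreal \<delta>"
proof -
  define i :: 'n where "i = undefined"
  define D where "D = density cube_lebesgue (\<lambda>z. ennreal (f z))"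
  define M where "M = distr D borel (\<lambda>z. z $ i)"
  have [measurable]: "f \<in> borel_measurable cube_lebesgue"
    using f by (simp add: is_cube_density_def)
  have spD [simp]: "space D = unit_cube" by (simp add: D_def)
  have coord [measurable]: "(\<lambda>z. z $ i) \<in> borel_measurable D"
    unfolding D_def by measurable
  interpret D: prob_space D
    using prob_space_cube_density[OF f] by (simp add: D_def)
  interpret M: real_distribution M
    unfolding M_def real_distribution_def real_distribution_axioms_def
    by (auto intro!: D.prob_space_distr)
  have null: "measure M {t} = 0" for t
  proof -
    have set: "{z \<in> unit_cube. z $ i = t} \<in> sets cube_lebesgue"
      unfolding space_cube_lebesgue[symmetric] by measurable
    have "emeasure cube_lebesgue {z \<in> unit_cube. z $ i = t}
        = (\<integral>\<^sup>+ z. indicator {t} (z $ i) \<partial>(cube_lebesgue :: (real ^ 'n) measure))"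
      unfolding nn_integral_indicator[OF set, symmetric]
      by (intro nn_integral_cong) (simp add: indicator_def)
    also have "\<dots> = (\<integral>\<^sup>+ s. indicator {t} s * indicator {0..1} s \<partial>lborel)"
      by (rule nn_integral_cube_coordinate) simp
    also have "\<dots> \<le> (\<integral>\<^sup>+ s. indicator {t} s \<partial>lborel)"
      by (intro nn_integral_mono) (simp add: indicator_def)
    also have "\<dots> = 0" by simp
    finally have "emeasure cube_lebesgue {z \<in> unit_cube. z $ i = t} = 0" by simp
    moreover note set
    ultimately have "{z \<in> unit_cube. z $ i = t} \<in> null_sets D"
      using absolutely_continuousI_density[of "\<lambda>z. ennreal (f z)" cube_lebesgue]
      by (auto simp: absolutely_continuous_def D_def null_sets_def)
    moreover have "(\<lambda>z. z $ i) -` {t} \<inter> space D = {z \<in> unit_cube. z $ i = t}" by auto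
    ultimately show ?thesis
      by (simp add: M_def emeasure_distr null_sets_def measure_def)
  qed
  \<comment> \<open>the last slab, \<open>j = N\<close>, ends at \<open>(N + 1) / N \<le> 2\<close>, outside of the unit interval\<close>
  then have "continuous_on {0..2} (cdf M)"
    by (simp add: continuous_at_imp_continuous_on M.isCont_cdf)
  then have "uniformly_continuous_on {0..2} (cdf M)"
    by (rule compact_uniformly_continuous) simp
  then obtain d where "d > 0" and
    d: "\<And>s t. s \<in> {0..2} \<Longrightarrow> t \<in> {0..2} \<Longrightarrow> dist s t < d \<Longrightarrow> dist (cdf M s) (cdf M t) < \<delta>"
    using \<open>\<delta> > 0\<close> unfolding uniformly_continuous_on_def by (metis dist_commute)
  obtain N where N: "N \<noteq> 0" "inverse (real N) < d"
    using real_arch_inverse[of d] \<open>d > 0\<close> by auto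
  define k where "k z = nat \<lfloor>real N * (z $ i)\<rfloor>" for z :: "real ^ 'n"
  show thesis
  proof
    show kM [measurable]: "k \<in> measurable cube_lebesgue (count_space UNIV)"
      unfolding k_def by measurable
    show kN: "k z \<le> N" if "z \<in> unit_cube" for z
    proof -
      have "real N * (z $ i) \<le> real N * 1"
        using that by (intro mult_left_mono) (auto simp: unit_cube_def)
      then show ?thesis unfolding k_def by linarith
    qed
    fix j
    show "emeasure (density cube_lebesgue (\<lambda>z. ennreal (f z))) {z \<in> unit_cube. k z = j} \<le> ennreal \<delta>"
    proof (cases "j \<le> N")
      case False
      then have "{z \<in> unit_cube. k z = j} = {}" using kN by auto
      then show ?thesis by (simp only: emeasure_empty zero_le)
    next
      case True
      let ?a = "real j / real N" and ?b = "real (Suc j) / real N"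
      have ab: "?a < ?b" "?a \<in> {0..2}" "?b \<in> {0..2}" "dist ?b ?a < d"
        using N True by (auto simp: field_simps dist_real_def)
      \<comment> \<open>its left face is added to \<open>{?a<..?b}\<close>, whose mass is an increment of \<open>cdf M\<close>\<close>
      have sub: "{z \<in> unit_cube. k z = j} \<subseteq> (\<lambda>z. z $ i) -` ({?a} \<union> {?a<..?b}) \<inter> space D"
      proof
        fix z assume "z \<in> {z \<in> unit_cube. k z = j}"
        then have z: "z \<in> unit_cube" and j: "j = k z" by auto
        have "0 \<le> real N * (z $ i)" using z by (simp add: unit_cube_def)
        then have "real j \<le> real N * (z $ i)" "real N * (z $ i) < real (Suc j)"
          unfolding j k_def by linarith+
        then have "?a \<le> z $ i" "z $ i < ?b" using N by (simp_all add: field_simps)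
        then show "z \<in> (\<lambda>z. z $ i) -` ({?a} \<union> {?a<..?b}) \<inter> space D"
          using z by auto
      qed
      have "emeasure D {z \<in> unit_cube. k z = j}
          \<le> emeasure D ((\<lambda>z. z $ i) -` ({?a} \<union> {?a<..?b}) \<inter> space D)"
        by (rule emeasure_mono[OF sub measurable_sets[OF coord]]) simp
      also have "\<dots> = emeasure M ({?a} \<union> {?a<..?b})"
        unfolding M_def by (rule emeasure_distr[OF coord, symmetric]) simp
      also have "\<dots> = ennreal (measure M ({?a} \<union> {?a<..?b}))"
        by (rule M.emeasure_eq_measure)
      also have "measure M ({?a} \<union> {?a<..?b}) \<le> measure M {?a} + measure M {?a<..?b}"
        by (rule measure_Un_le) auto
      also have "\<dots> = cdf M ?b - cdf M ?a"
        using M.cdf_diff_eq[OF ab(1)] null by simp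
      also have "\<dots> \<le> \<delta>" using d[OF ab(3,2,4)] by (simp add: dist_real_def)
      finally show ?thesis by (simp add: D_def ennreal_leI)
    qed
  qed
qed

section \<open>Tilting the uniform density cell by cell\<close>

text \<open>
  The set \<open>S\<close> lists the cells with a positive sign, and \<open>k z\<close> is the cell of \<open>z\<close>.
\<close>

definition sign_tilt :: "(real ^ 'dx \<Rightarrow> real) \<Rightarrow> (real ^ 'dz \<Rightarrow> 'j) \<Rightarrow> 'j set \<Rightarrow>
    real ^ 'dx \<Rightarrow> real ^ 'dz \<Rightarrow> real" where
  "sign_tilt g k S x z = 1 + (if k z \<in> S then 1 else -1) * g x"

lemma sign_tilt_measurable:
  assumes [measurable]: "g \<in> borel_measurable cube_lebesgue"
    "k \<in> measurable cube_lebesgue (count_space UNIV)"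
  shows "(\<lambda>(x, z). sign_tilt g k S x z) \<in> borel_measurable joint_cube"
proof -
  have [measurable]: "S \<in> sets (count_space UNIV)" by simp
  show ?thesis unfolding sign_tilt_def by measurable
qed

lemma sign_tilt_agree:
  "k z \<noteq> j \<Longrightarrow> sign_tilt g k (insert j S) x z = sign_tilt g k S x z"
  by (simp add: sign_tilt_def)

text \<open>
  On the cell \<open>j\<close> the two candidates are \<open>1 - g\<close> and \<open>1 + g\<close>, so by the triangle inequality the two
  distances from \<open>q'\<close> add up to at least \<open>2\<bar>g\<bar>\<close>, for whatever \<open>q'\<close>.
\<close>

lemma strip_loss_separation:
  fixes g :: "real ^ 'dx \<Rightarrow> real" and k :: "real ^ 'dz \<Rightarrow> 'j"
  assumes f: "is_cube_density f" and g [measurable]: "g \<in> borel_measurable cube_lebesgue"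
    and k [measurable]: "k \<in> measurable cube_lebesgue (count_space UNIV)"
    and q' [measurable]: "(\<lambda>(x, z). q' x z) \<in> borel_measurable joint_cube"
    and j: "j \<notin> S"
  defines "A \<equiv> {z \<in> unit_cube. k z = j}"
  shows "2 * (emeasure (density cube_lebesgue (\<lambda>z. ennreal (f z))) A
            * (\<integral>\<^sup>+ x. ennreal \<bar>g x\<bar> \<partial>cube_lebesgue))
      \<le> strip_loss f q' (sign_tilt g k S) A + strip_loss f q' (sign_tilt g k (insert j S)) A"
proof -
  have [measurable]: "f \<in> borel_measurable cube_lebesgue"
    using f by (simp add: is_cube_density_def)
  have A [measurable]: "A \<in> sets cube_lebesgue"
    unfolding A_def space_cube_lebesgue[symmetric] by measurable
  note [measurable] = sign_tilt_measurable[OF g k]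
  have "2 * (emeasure (density cube_lebesgue (\<lambda>z. ennreal (f z))) A
            * (\<integral>\<^sup>+ x. ennreal \<bar>g x\<bar> \<partial>cube_lebesgue))
      = 2 * (\<integral>\<^sup>+ z. (\<integral>\<^sup>+ x. ennreal \<bar>g x\<bar> * (ennreal (f z) * indicator A z) \<partial>cube_lebesgue) \<partial>cube_lebesgue)"
    by (simp add: emeasure_density nn_integral_multc nn_integral_cmult mult.commute)
  also have "\<dots> = (\<integral>\<^sup>+ (x, z). 2 * (ennreal \<bar>g x\<bar> * (ennreal (f z) * indicator A z)) \<partial>joint_cube)"
    by (subst joint_cube.nn_integral_snd[symmetric]) (auto simp: split_beta' nn_integral_cmult)
  also have "\<dots> \<le> (\<integral>\<^sup>+ (x, z). ennreal (\<bar>q' x z - sign_tilt g k S x z\<bar> * f z) * indicator A z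
      + ennreal (\<bar>q' x z - sign_tilt g k (insert j S) x z\<bar> * f z) * indicator A z \<partial>joint_cube)"
  proof (intro nn_integral_mono, clarsimp simp: space_pair_measure)
    fix x :: "real ^ 'dx" and z :: "real ^ 'dz" assume z: "z \<in> unit_cube"
    have fz: "0 \<le> f z" using f z by (simp add: is_cube_density_def)
    show "2 * (ennreal \<bar>g x\<bar> * (ennreal (f z) * indicator A z))
        \<le> ennreal (\<bar>q' x z - sign_tilt g k S x z\<bar> * f z) * indicator A z
        + ennreal (\<bar>q' x z - sign_tilt g k (insert j S) x z\<bar> * f z) * indicator A z"
    proof (cases "z \<in> A")
      case True
      then have "sign_tilt g k S x z = 1 - g x" "sign_tilt g k (insert j S) x z = 1 + g x"
        using j by (auto simp: sign_tilt_def A_def)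
      then have "2 * \<bar>g x\<bar> * f z \<le> \<bar>q' x z - sign_tilt g k S x z\<bar> * f z
          + \<bar>q' x z - sign_tilt g k (insert j S) x z\<bar> * f z"
        using fz unfolding distrib_right[symmetric] by (intro mult_right_mono) auto
      then have "ennreal (2 * \<bar>g x\<bar> * f z) \<le> ennreal (\<bar>q' x z - sign_tilt g k S x z\<bar> * f z)
          + ennreal (\<bar>q' x z - sign_tilt g k (insert j S) x z\<bar> * f z)"
        using fz by (simp flip: ennreal_plus add: ennreal_leI)
      then show ?thesis using True fz by (simp add: ennreal_mult mult.assoc)
    qed simp
  qed
  also have "\<dots> = strip_loss f q' (sign_tilt g k S) A + strip_loss f q' (sign_tilt g k (insert j S)) A"
    unfolding strip_loss_def by (subst nn_integral_add[symmetric]) (auto simp: split_beta')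
  finally show ?thesis .
qed

text \<open>
  Assouad's lemma applied to the laws \<open>joint_law f (sign_tilt g k S)\<close>, the loss being split into its
  parts on the cells.  An observation \<open>(x, z)\<close> is uninformative about \<open>j\<close> if \<open>z\<close> is not in the
  cell \<open>j\<close>, which has probability at least \<open>1 - \<delta>\<close>.
\<close>

lemma tilted_family_risk:
  fixes p_hat :: "(nat \<Rightarrow> (real ^ 'dx) \<times> (real ^ 'dz)) \<Rightarrow> real ^ 'dx \<Rightarrow> real ^ 'dz \<Rightarrow> real"
    and g :: "real ^ 'dx \<Rightarrow> real" and k :: "real ^ 'dz \<Rightarrow> 'j"
  assumes f: "is_cube_density f" and g [measurable]: "g \<in> borel_measurable cube_lebesgue"
    and k [measurable]: "k \<in> measurable cube_lebesgue (count_space UNIV)"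
    and J: "finite J" "\<And>z. z \<in> unit_cube \<Longrightarrow> k z \<in> J"
    and small: "\<And>j. emeasure (density cube_lebesgue (\<lambda>z. ennreal (f z))) {z \<in> unit_cube. k z = j}
                  \<le> ennreal \<delta>"
    and dens: "\<And>S z. z \<in> unit_cube \<Longrightarrow> is_cube_density (\<lambda>x. sign_tilt g k S x z)"
    and p_hat: "p_hat \<in> estimators n" and \<delta>: "0 \<le> \<delta>"
  shows "\<exists>S\<subseteq>J. ennreal (1 - real n * \<delta>) * (\<integral>\<^sup>+ x. ennreal \<bar>g x\<bar> \<partial>cube_lebesgue)
            \<le> L1_risk n f (joint_law f (sign_tilt g k S)) (sign_tilt g k S) p_hat"
proof -
  define D where "D = density cube_lebesgue (\<lambda>z. ennreal (f z))"
  define cell where "cell j = {z \<in> unit_cube. k z = j}" for j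
  define P where "P S = joint_law f (sign_tilt g k S)" for S
  let ?G = "\<integral>\<^sup>+ x. ennreal \<bar>g x\<bar> \<partial>cube_lebesgue"
  let ?B = "\<lambda>j. unit_cube \<times> (unit_cube - cell j) :: ((real ^ 'dx) \<times> (real ^ 'dz)) set"
  have f_meas [measurable]: "f \<in> borel_measurable cube_lebesgue"
    using f by (simp add: is_cube_density_def)
  interpret D: prob_space D unfolding D_def by (rule prob_space_cube_density[OF f])
  have spD [simp]: "space D = unit_cube" and setsD [simp]: "sets D = sets cube_lebesgue"
    by (simp_all add: D_def)
  note tilt [measurable] = sign_tilt_measurable[OF g k]
  have cell [measurable]: "cell j \<in> sets cube_lebesgue" for j
    unfolding cell_def space_cube_lebesgue[symmetric] by measurable
  have cube: "unit_cube \<in> sets cube_lebesgue"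
    using sets.top[of cube_lebesgue] by simp
  have setsP: "sets (P S) = sets joint_cube" for S by (simp add: P_def joint_law_def)
  have probP: "prob_space (P S)" for S
    using joint_law_properties(1)[OF f tilt dens] by (simp add: P_def ac_distribution_def)
  have mass: "(\<Sum>j\<in>J. emeasure D (cell j)) = 1"
  proof -
    have "(\<Sum>j\<in>J. emeasure D (cell j)) = emeasure D (\<Union>j\<in>J. cell j)"
      using J(1) by (intro sum_emeasure) (auto simp: disjoint_family_on_def cell_def cell[unfolded cell_def])
    also have "(\<Union>j\<in>J. cell j) = space D" using J(2) by (auto simp: cell_def)
    finally show ?thesis by (simp only: D.emeasure_space_1)
  qed
  have "\<exists>S\<subseteq>J. ennreal (1 - real n * \<delta>) * (\<Sum>j\<in>J. emeasure D (cell j) * ?G)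
      \<le> (\<integral>\<^sup>+ \<omega>. (\<Sum>j\<in>J. strip_loss f (p_hat \<omega>) (sign_tilt g k S) (cell j)) \<partial>PiM {..<n} (\<lambda>_. P S))"
  proof (rule assouad[where B = ?B and M = joint_cube])
    show "?B j \<in> sets joint_cube" for j
      by (intro pair_measureI sets.Diff cube cell)
    show "emeasure (P S) A = emeasure (P (insert j S)) A" if "A \<in> sets joint_cube" "A \<subseteq> ?B j" for j S A
    proof -
      have "sign_tilt g k (insert j S) x z = sign_tilt g k S x z" if "(x, z) \<in> A" for x z
        using that \<open>A \<subseteq> ?B j\<close> by (intro sign_tilt_agree) (auto simp: cell_def)
      then show ?thesis
        unfolding P_def joint_law_def using that
        by (subst (1 2) emeasure_density) (auto intro!: nn_integral_cong simp: indicator_def)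
    qed
    show "1 - \<delta> \<le> measure (P S) (?B j)" for j S
    proof -
      have "measure D (cell j) \<le> \<delta>"
        using small[of j] \<delta> by (simp add: D_def[symmetric] cell_def[symmetric] D.emeasure_eq_measure)
      moreover have "emeasure (P S) (?B j) = emeasure D (unit_cube - cell j)"
        unfolding P_def D_def using cube cell by (intro emeasure_joint_law_strip f tilt dens) auto
      then have "measure (P S) (?B j) = measure D (unit_cube - cell j)"
        by (simp add: measure_def)
      ultimately show ?thesis using D.prob_compl[of "cell j"] cell by simp
    qed
    show "(\<lambda>\<omega>. strip_loss f (p_hat \<omega>) (sign_tilt g k S) (cell j))
        \<in> borel_measurable (PiM {..<n} (\<lambda>_. joint_cube))" for j S
      by (rule strip_loss_measurable[OF f_meas tilt cell p_hat])
    show "2 * (emeasure D (cell j) * ?G) \<le> strip_loss f (p_hat \<omega>) (sign_tilt g k S) (cell j)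
        + strip_loss f (p_hat \<omega>) (sign_tilt g k (insert j S)) (cell j)"
      if "j \<in> J" "j \<notin> S" "\<omega> \<in> space (PiM {..<n} (\<lambda>_. joint_cube))" for j S \<omega>
      unfolding D_def cell_def
      by (rule strip_loss_separation[OF f g k estimator_section_measurable[OF p_hat that(3)] that(2)])
  qed (fact J(1) probP setsP)+
  then obtain S where S: "S \<subseteq> J" and le: "ennreal (1 - real n * \<delta>) * (\<Sum>j\<in>J. emeasure D (cell j) * ?G)
      \<le> (\<integral>\<^sup>+ \<omega>. (\<Sum>j\<in>J. strip_loss f (p_hat \<omega>) (sign_tilt g k S) (cell j)) \<partial>PiM {..<n} (\<lambda>_. P S))"
    by blast
  have "sets (PiM {..<n} (\<lambda>_. P S)) = sets (PiM {..<n} (\<lambda>_. joint_cube))"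
    by (intro sets_PiM_cong) (simp_all add: setsP)
  note space = sets_eq_imp_space_eq[OF this]
  have "(\<integral>\<^sup>+ \<omega>. (\<Sum>j\<in>J. strip_loss f (p_hat \<omega>) (sign_tilt g k S) (cell j)) \<partial>PiM {..<n} (\<lambda>_. P S))
      = L1_risk n f (P S) (sign_tilt g k S) p_hat"
    unfolding L1_risk_def
  proof (rule nn_integral_cong)
    fix \<omega> assume "\<omega> \<in> space (PiM {..<n} (\<lambda>_. P S))"
    then have sect: "(\<lambda>(x, z). p_hat \<omega> x z) \<in> borel_measurable joint_cube"
      using p_hat space by (intro estimator_section_measurable) auto
    show "(\<Sum>j\<in>J. strip_loss f (p_hat \<omega>) (sign_tilt g k S) (cell j)) = L1_loss f (p_hat \<omega>) (sign_tilt g k S)"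
      unfolding L1_loss_eq_strip_loss[OF f_meas tilt sect] cell_def
      by (rule strip_loss_partition[OF f_meas tilt sect k J, symmetric])
  qed
  moreover have "(\<Sum>j\<in>J. emeasure D (cell j) * ?G) = ?G"
    using mass by (simp flip: sum_distrib_right)
  ultimately show ?thesis using S le by (auto simp: P_def)
qed

section \<open>Hoelder smoothness of affine functions\<close>

text \<open>
  Only the values on the cube are constrained, because a partial derivative within the cube is
  unspecified at the points outside.
\<close>

definition affine_on_cube :: "(real ^ 'n \<Rightarrow> real) \<Rightarrow> bool" where
  "affine_on_cube f \<longleftrightarrow> (\<exists>a v. \<forall>x\<in>unit_cube. f x = a + v \<bullet> x)"

text \<open>
  The segment through \<open>x\<close> in direction \<open>i\<close> is never reduced to \<open>x\<close>, so one-sided derivatives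
  are unique even on the faces of the cube.
\<close>

lemma cube_slice_nontrivial:
  fixes x :: "real ^ 'n"
  assumes "x \<in> unit_cube"
  shows "at 0 within {t. x + t *\<^sub>R axis i 1 \<in> unit_cube} \<noteq> bot"
proof -
  let ?T = "{t. x + t *\<^sub>R axis i 1 \<in> unit_cube}"
  have "?T = {- (x $ i)..1 - x $ i}"
    using assms by (auto simp: unit_cube_def axis_def)
  moreover have "0 \<in> {- (x $ i)..1 - x $ i}" using assms by (auto simp: unit_cube_def)
  ultimately show ?thesis
    by (simp add: trivial_limit_within islimpt_Icc)
qed

lemma partial_deriv_affine:
  fixes x :: "real ^ 'n"
  assumes f: "\<And>y. y \<in> unit_cube \<Longrightarrow> f y = a + v \<bullet> y" and x: "x \<in> unit_cube"
  shows "partial_deriv i f x = v $ i"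
  unfolding partial_deriv_def
proof (rule vector_derivative_within[OF cube_slice_nontrivial[OF x]])
  let ?T = "{t. x + t *\<^sub>R axis i 1 \<in> unit_cube}"
  have "((\<lambda>t. a + v \<bullet> x + t * (v $ i)) has_vector_derivative v $ i) (at 0 within ?T)"
    by (auto intro!: derivative_eq_intros)
  then show "((\<lambda>t. f (x + t *\<^sub>R axis i 1)) has_vector_derivative v $ i) (at 0 within ?T)"
    by (rule has_vector_derivative_transform[rotated 2])
       (use x in \<open>auto simp: f inner_add_right inner_axis\<close>)
qed

lemma affine_on_cube_partial_deriv:
  assumes "affine_on_cube f"
  shows "affine_on_cube (partial_deriv i f)"
    and "\<exists>b. \<forall>x\<in>unit_cube. partial_deriv i f x = b"
proof -
  obtain a v where "\<And>x. x \<in> unit_cube \<Longrightarrow> f x = a + v \<bullet> x"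
    using assms by (auto simp: affine_on_cube_def)
  note d = partial_deriv_affine[OF this]
  then show "\<exists>b. \<forall>x\<in>unit_cube. partial_deriv i f x = b" by blast
  show "affine_on_cube (partial_deriv i f)"
    unfolding affine_on_cube_def by (rule exI[of _ "v $ i"], rule exI[of _ 0]) (simp add: d)
qed

lemma times_differentiable_affine:
  "affine_on_cube f \<Longrightarrow> times_differentiable k f"
proof (induction k arbitrary: f)
  case (Suc k)
  obtain a v where f: "\<And>x. x \<in> unit_cube \<Longrightarrow> f x = a + v \<bullet> x"
    using Suc.prems by (auto simp: affine_on_cube_def)
  have aff: "(\<lambda>x. a + v \<bullet> x) differentiable_on unit_cube"
    by (intro differentiable_on_add differentiable_on_const linear_imp_differentiable_on
        bounded_linear.linear bounded_linear_inner_right)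
  have "f differentiable (at x within unit_cube)" if "x \<in> unit_cube" for x
  proof (rule differentiable_transform_within[OF _ zero_less_one that])
    show "(\<lambda>x. a + v \<bullet> x) differentiable (at x within unit_cube)"
      using aff that by (simp add: differentiable_on_def)
  qed (simp add: f)
  then have "f differentiable_on unit_cube" by (simp add: differentiable_on_def)
  then show ?case using Suc affine_on_cube_partial_deriv(1) by auto
qed simp

text \<open>
  Every intermediate derivative is affine, and the first derivative that is really taken makes
  it constant; the later ones keep it so.
\<close>

lemma multi_deriv_affine_const:
  fixes f :: "real ^ 'n \<Rightarrow> real"
  assumes f: "affine_on_cube f" and \<alpha>: "sum \<alpha> UNIV \<noteq> 0"
  shows "\<exists>b. \<forall>x\<in>unit_cube. multi_deriv \<alpha> f x = b"
proof -
  have "\<exists>is :: 'n list. distinct is \<and> set is = UNIV"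
    using finite_distinct_list[OF finite] by metis
  then have coords: "set (coordinates :: 'n list) = UNIV"
    unfolding coordinates_def by (rule someI2_ex) simp
  have const: "\<exists>b. \<forall>x\<in>unit_cube. (partial_deriv i ^^ k) g x = b"
    if "affine_on_cube g" "k \<noteq> 0 \<or> (\<exists>b. \<forall>x\<in>unit_cube. g x = b)" for g i k
    using that(2)
  proof (induction k)
    case (Suc k)
    have "affine_on_cube ((partial_deriv i ^^ k) g)"
      using that(1) by (induction k) (auto intro: affine_on_cube_partial_deriv(1))
    then show ?case using affine_on_cube_partial_deriv(2) by simp
  qed auto
  have aff: "affine_on_cube ((partial_deriv i ^^ k) g)" if "affine_on_cube g" for g i k
    using that by (induction k) (auto intro: affine_on_cube_partial_deriv(1))
  let ?D = "\<lambda>is. foldr (\<lambda>i g. (partial_deriv i ^^ \<alpha> i) g) is f"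
  have affD: "affine_on_cube (?D is)" for "is"
    using f by (induction "is") (auto intro: aff)
  have "\<exists>b. \<forall>x\<in>unit_cube. ?D is x = b" if "\<exists>i\<in>set is. \<alpha> i \<noteq> 0" for "is"
    using that by (induction "is") (auto intro!: const affD)
  moreover have "\<exists>i\<in>set (coordinates :: 'n list). \<alpha> i \<noteq> 0"
    using \<alpha> coords by (auto intro: ccontr)
  ultimately show ?thesis unfolding multi_deriv_def by blast
qed

lemma multi_deriv_zero: "multi_deriv (\<lambda>_. 0) f = f"
proof -
  have "foldr (\<lambda>i g. (partial_deriv i ^^ 0) g) is f = f" for "is" by (induction "is") auto
  then show ?thesis unfolding multi_deriv_def by blast
qed

lemma strict_floor_bounds:
  assumes "\<beta> > 0"
  shows "real (strict_floor \<beta>) < \<beta>" "\<beta> \<le> real (strict_floor \<beta>) + 1"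
proof -
  have bound: "k \<le> nat \<lceil>\<beta>\<rceil>" if "real k < \<beta>" for k using that by linarith
  show "real (strict_floor \<beta>) < \<beta>"
    unfolding strict_floor_def using assms bound by (rule GreatestI_nat[of "\<lambda>k. real k < \<beta>" 0, simplified])
  show "\<beta> \<le> real (strict_floor \<beta>) + 1"
  proof (rule ccontr)
    assume "\<not> ?thesis"
    then have "real (Suc (strict_floor \<beta>)) < \<beta>" by simp
    then have "Suc (strict_floor \<beta>) \<le> strict_floor \<beta>"
      unfolding strict_floor_def[of \<beta>] using bound
      by (rule Greatest_le_nat[of "\<lambda>k. real k < \<beta>"])
    then show False by simp
  qed
qed

text \<open>
  For \<open>\<beta> > 1\<close> the derivatives of order \<open>\<lfloor>\<beta>\<rfloor>\<close> are constant in \<open>x\<close>, whatever the slope.  For \<open>\<beta> \<le> 1\<close> no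
  derivative is taken, and \<open>t \<le> t\<^sup>\<beta>\<close> for \<open>t = \<bar>x\<^sub>i - y\<^sub>i\<bar> \<le> 1\<close>.
\<close>

lemma holder_smooth_affine:
  fixes q :: "real ^ 'dx \<Rightarrow> real ^ 'dz \<Rightarrow> real"
  assumes \<beta>: "\<beta> > 0" and W: "W > 0"
    and c: "0 \<le> c" "\<beta> \<le> 1 \<Longrightarrow> c \<le> W"
    and q: "\<And>x z. q x z = a z + c * s z * x $ i" and s: "\<And>z. \<bar>s z\<bar> \<le> 1"
  shows "holder_smooth W \<beta> q"
proof -
  have aff: "affine_on_cube (\<lambda>x. q x z)" for z
    unfolding affine_on_cube_def
    by (rule exI[of _ "a z"], rule exI[of _ "axis i (c * s z)"]) (simp add: q inner_axis')
  have "\<bar>multi_deriv \<alpha> (\<lambda>x. q x z) x - multi_deriv \<alpha> (\<lambda>x. q x z) y\<bar>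
      \<le> W * l1_norm (x - y) powr (\<beta> - real (strict_floor \<beta>))"
    if x: "x \<in> unit_cube" and y: "y \<in> unit_cube" and \<alpha>: "sum \<alpha> UNIV = strict_floor \<beta>"
    for x y z and \<alpha> :: "'dx \<Rightarrow> nat"
  proof (cases "\<beta> \<le> 1")
    case False
    then have "sum \<alpha> UNIV \<noteq> 0"
      using strict_floor_bounds(2)[OF \<beta>] \<alpha> by auto
    then have "multi_deriv \<alpha> (\<lambda>x. q x z) x = multi_deriv \<alpha> (\<lambda>x. q x z) y"
      using multi_deriv_affine_const[OF aff] x y by metis
    then show ?thesis using W by simp
  next
    case True
    then have 0: "strict_floor \<beta> = 0" using strict_floor_bounds(1)[OF \<beta>] by simp
    with \<alpha> have "\<alpha> = (\<lambda>_. 0)" by auto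
    then have D: "multi_deriv \<alpha> (\<lambda>x. q x z) = (\<lambda>x. q x z)" by (simp add: multi_deriv_zero)
    let ?t = "\<bar>x $ i - y $ i\<bar>"
    have t: "0 \<le> ?t" "?t \<le> 1" using x y unfolding unit_cube_def mem_Collect_eq by (smt (verit))+
    have "?t \<le> ?t powr \<beta>"
      using powr_mono'[of \<beta> 1 ?t] True t by simp
    also have "\<dots> \<le> l1_norm (x - y) powr \<beta>"
      using \<beta> member_le_sum[of i UNIV "\<lambda>i. \<bar>(x - y) $ i\<bar>"]
      by (intro powr_mono2) (auto simp: l1_norm_def)
    finally have le: "?t \<le> l1_norm (x - y) powr \<beta>" .
    have "\<bar>q x z - q y z\<bar> = c * \<bar>s z\<bar> * ?t"
      using c(1) by (simp add: q abs_mult flip: right_diff_distrib)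
    also have "\<dots> \<le> W * 1 * l1_norm (x - y) powr \<beta>"
      using c True s W le by (intro mult_mono) auto
    finally show ?thesis by (simp add: D 0)
  qed
  then show ?thesis
    unfolding holder_smooth_def using times_differentiable_affine[OF aff] by blast
qed

section \<open>The linear profile\<close>

definition linear_profile :: "'n \<Rightarrow> real \<Rightarrow> real ^ 'n \<Rightarrow> real" where
  "linear_profile i c x = c * (x $ i - 1 / 2)"

lemma linear_profile_measurable [measurable]:
  "linear_profile i c \<in> borel_measurable cube_lebesgue"
  unfolding linear_profile_def[abs_def] by measurable

lemma linear_profile_bound:
  assumes "0 \<le> c" "c \<le> 2" "x \<in> unit_cube"
  shows "\<bar>linear_profile i c x\<bar> \<le> 1"
proof -
  have "0 \<le> x $ i" "x $ i \<le> 1" using assms(3) by (auto simp: unit_cube_def)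
  then have "\<bar>x $ i - 1 / 2\<bar> \<le> 1 / 2" by linarith
  then have "c * \<bar>x $ i - 1 / 2\<bar> \<le> 2 * (1 / 2)" using assms by (intro mult_mono) auto
  then show ?thesis using assms by (simp add: linear_profile_def abs_mult)
qed

lemma nn_integral_one_plus_profile:
  assumes "\<bar>a\<bar> \<le> 2"
  shows "(\<integral>\<^sup>+ x. ennreal (1 + linear_profile i a x) \<partial>cube_lebesgue) = 1"
proof -
  have "(\<integral>\<^sup>+ x. ennreal (1 + linear_profile i a x) \<partial>cube_lebesgue)
      = (\<integral>\<^sup>+ t. ennreal (1 + a * (t - 1 / 2)) * indicator {0..1} t \<partial>lborel)"
    unfolding linear_profile_def by (rule nn_integral_cube_coordinate) measurable
  also have "\<dots> = ennreal ((1 + a * (1 ^ 2 / 2 - 1 / 2)) - (0 + a * (0 ^ 2 / 2 - 0 / 2)))"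
  proof (rule nn_integral_FTC_Icc[where F = "\<lambda>t. t + a * (t ^ 2 / 2 - t / 2)"])
    fix t :: real assume "t \<in> {0..1}"
    then have half: "\<bar>t - 1 / 2\<bar> \<le> 1 / 2" unfolding atLeastAtMost_iff by linarith
    have "\<bar>a * (t - 1 / 2)\<bar> \<le> 2 * (1 / 2)"
      unfolding abs_mult by (rule mult_mono[OF assms half]) simp_all
    then show "0 \<le> 1 + a * (t - 1 / 2)" by linarith
  qed (auto intro!: derivative_eq_intros simp: field_simps)
  finally show ?thesis by simp
qed

text \<open>
  For \<open>\<bar>u\<bar> \<le> 1/2\<close> one has \<open>\<bar>u\<bar> \<ge> 2u\<^sup>2\<close>.  The polynomial minorant has integral \<open>c/6\<close> instead of the exact
  value \<open>c/4\<close>, but an antiderivative without case distinction, and \<open>c/6\<close> is far above what is required.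
\<close>

lemma nn_integral_abs_profile:
  assumes "0 \<le> c"
  shows "ennreal (c / 6) \<le> (\<integral>\<^sup>+ x. ennreal \<bar>linear_profile i c x\<bar> \<partial>cube_lebesgue)"
proof -
  have "ennreal (c / 6) = ennreal (2 * c * (1 - 1 / 2) ^ 3 / 3 - 2 * c * (0 - 1 / 2) ^ 3 / 3)"
    by (simp add: power3_eq_cube)
  also have "\<dots> = (\<integral>\<^sup>+ t. ennreal (2 * c * (t - 1 / 2) ^ 2) * indicator {0..1} t \<partial>lborel)"
    using assms by (intro nn_integral_FTC_Icc[where F = "\<lambda>t. 2 * c * (t - 1 / 2) ^ 3 / 3", symmetric])
      (auto intro!: derivative_eq_intros simp: power2_eq_square)
  also have "\<dots> \<le> (\<integral>\<^sup>+ t. ennreal \<bar>c * (t - 1 / 2)\<bar> * indicator {0..1} t \<partial>lborel)"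
  proof (intro nn_integral_mono)
    fix t :: real
    have "2 * c * (t - 1 / 2) ^ 2 \<le> \<bar>c * (t - 1 / 2)\<bar>" if "t \<in> {0..1}"
    proof -
      have "\<bar>t - 1 / 2\<bar> \<le> 1 / 2" using that unfolding atLeastAtMost_iff by linarith
      then have "2 * (\<bar>t - 1 / 2\<bar> * \<bar>t - 1 / 2\<bar>) \<le> \<bar>t - 1 / 2\<bar>"
        using mult_right_mono[of "\<bar>t - 1 / 2\<bar>" "1 / 2" "\<bar>t - 1 / 2\<bar>"] by simp
      from mult_left_mono[OF this assms] show ?thesis
        using assms by (simp add: abs_mult power2_eq_square mult_ac)
    qed
    then show "ennreal (2 * c * (t - 1 / 2) ^ 2) * indicator {0..1} t
        \<le> ennreal \<bar>c * (t - 1 / 2)\<bar> * indicator {0..1} t"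
      by (auto simp: indicator_def intro: ennreal_leI)
  qed
  also have "\<dots> = (\<integral>\<^sup>+ x. ennreal \<bar>linear_profile i c x\<bar> \<partial>cube_lebesgue)"
    unfolding linear_profile_def by (rule nn_integral_cube_coordinate[symmetric]) measurable
  finally show ?thesis .
qed

lemma sign_tilt_density:
  assumes "0 \<le> c" "c \<le> 2"
  shows "is_cube_density (\<lambda>x. sign_tilt (linear_profile i c) k S x z)"
proof -
  let ?a = "(if k z \<in> S then c else - c)"
  have tilt: "sign_tilt (linear_profile i c) k S x z = 1 + linear_profile i ?a x" for x
    by (simp add: sign_tilt_def linear_profile_def)
  have "(\<integral>\<^sup>+ x. ennreal (1 + linear_profile i ?a x) \<partial>cube_lebesgue) = 1"
    using assms by (intro nn_integral_one_plus_profile) auto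
  moreover have "0 \<le> sign_tilt (linear_profile i c) k S x z" if "x \<in> unit_cube" for x
    using linear_profile_bound[OF assms that, of i] by (auto simp: sign_tilt_def)
  ultimately show ?thesis unfolding is_cube_density_def by (simp add: tilt)
qed

lemma sign_tilt_holder:
  assumes "\<beta> > 0" "W > 0" "0 \<le> c" "\<beta> \<le> 1 \<Longrightarrow> c \<le> W"
  shows "holder_smooth W \<beta> (sign_tilt (linear_profile i c) k S)"
  by (rule holder_smooth_affine[OF assms, where i = i
        and s = "\<lambda>z. if k z \<in> S then 1 else -1"
        and a = "\<lambda>z. 1 - (if k z \<in> S then 1 else -1) * c / 2"])
     (auto simp: sign_tilt_def linear_profile_def algebra_simps)

text \<open>
  In the first case of \<^const>\<open>kappa\<close> one has \<open>W \<le> W d\<^sup>\<beta> < 2\<close>, so \<open>c = W\<close>, and \<open>\<kappa>\<close> is at most \<open>W\<close> times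
  \<open>W d\<^sup>\<beta>/144 < 1/72\<close>, since \<open>2\<beta> - 1 \<le> \<beta>\<close>.  Otherwise \<open>c \<ge> 2/d\<close>, since \<open>d\<^sup>\<beta> \<le> d\<close> when \<open>\<beta> \<le> 1\<close>.
\<close>

lemma kappa_le_slope:
  assumes "d \<ge> 1" "\<beta> > 0" "W > 0"
  defines "c \<equiv> if \<beta> \<le> 1 then min W 2 else 2"
  shows "kappa d \<beta> W \<le> c / 6"
proof -
  have d: "1 \<le> real d" using assms(1) by simp
  show ?thesis
  proof (cases "\<beta> \<le> 1 \<and> W < 2 / real d powr \<beta>")
    case True
    have pos: "1 \<le> real d powr \<beta>" using d assms(2) by (simp add: ge_one_powr_ge_zero)
    have Wd: "W * real d powr \<beta> < 2" using True pos pos_less_divide_eq[of "real d powr \<beta>" W 2] assms(1) by simp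
    have "W \<le> W * real d powr \<beta>" using pos assms(3) by simp
    with Wd have c: "c = W" using True by (simp add: c_def)
    have "real d powr (2 * \<beta> - 1) = real d powr \<beta> * real d powr (\<beta> - 1)"
      by (simp flip: powr_add)
    also have "\<dots> \<le> real d powr \<beta> * 1"
      using d True powr_mono[of "\<beta> - 1" 0 "real d"] by (intro mult_left_mono) auto
    finally have "W * real d powr (2 * \<beta> - 1) \<le> W * real d powr \<beta>"
      using assms(3) by simp
    then have "W * real d powr (2 * \<beta> - 1) \<le> 2" using Wd by linarith
    then have "W * (W * real d powr (2 * \<beta> - 1)) \<le> W * 2"
      using assms(3) by (intro mult_left_mono) auto
    then show ?thesis using True c assms(3) by (simp add: kappa_def power2_eq_square mult.assoc)
  next
    case False
    have "2 / real d \<le> c"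
    proof (cases "\<beta> \<le> 1")
      case True
      have "real d powr \<beta> \<le> real d" using powr_mono[of \<beta> 1 "real d"] True d by simp
      then have "2 / real d \<le> 2 / real d powr \<beta>"
        using d by (intro divide_left_mono) (auto intro!: mult_pos_pos)
      also have "\<dots> \<le> W" using True False by simp
      finally show ?thesis using True d by (simp add: c_def field_simps)
    qed (use d in \<open>simp add: c_def field_simps\<close>)
    then have "(2 / real d) / 6 \<le> c / 6" by (rule divide_right_mono) simp
    moreover have "1 / (36 * real d) \<le> (2 / real d) / 6" using d by (simp add: field_simps)
    ultimately show ?thesis unfolding kappa_def if_not_P[OF False] by (rule order_trans[rotated])
  qed
qed

section \<open>The lower bound\<close>

theorem theorem2p2:
  fixes n :: nat and p_Z :: "real ^ 'dz \<Rightarrow> real" and \<beta> W\<^sub>1 \<epsilon> :: real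
  assumes "n \<ge> 1"
    and "is_cube_density p_Z"
    and "\<beta> > 0" and "W\<^sub>1 > 0" and "\<epsilon> > 0"
  shows "\<exists>(C :: ((real ^ 'dx) \<times> (real ^ 'dz)) measure set)
            (p_XZ :: ((real ^ 'dx) \<times> (real ^ 'dz)) measure \<Rightarrow> real ^ 'dx \<Rightarrow> real ^ 'dz \<Rightarrow> real).
     finite C \<and> C \<noteq> {} \<and>
     (\<forall>P\<in>C. ac_distribution P \<and>
            has_Z_marginal_density P p_Z \<and>
            is_conditional_density P p_Z (p_XZ P) \<and>
            holder_smooth W\<^sub>1 \<beta> (p_XZ P)) \<and>
     (INF p_hat\<in>estimators n. Max ((\<lambda>P. L1_risk n p_Z P (p_XZ P) p_hat) ` C))
       \<ge> ennreal (kappa CARD('dx) \<beta> W\<^sub>1 - \<epsilon>)"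
proof -
  \<comment> \<open>any coordinate will do\<close>
  define i :: 'dx where "i = undefined"
  define c where "c = (if \<beta> \<le> 1 then min W\<^sub>1 2 else 2)"
  have c: "0 \<le> c" "c \<le> 2" "\<beta> \<le> 1 \<Longrightarrow> c \<le> W\<^sub>1" using assms(4) by (auto simp: c_def)
  have \<kappa>: "kappa CARD('dx) \<beta> W\<^sub>1 \<le> c / 6"
    using kappa_le_slope[of "CARD('dx)", OF _ assms(3,4)] by (simp add: c_def Suc_leI)
  define g where "g = linear_profile i c"
  have g [measurable]: "g \<in> borel_measurable cube_lebesgue" unfolding g_def by measurable
  obtain k :: "real ^ 'dz \<Rightarrow> nat" and N where k: "k \<in> measurable cube_lebesgue (count_space UNIV)"
    and kN: "\<And>z. z \<in> unit_cube \<Longrightarrow> k z \<le> N"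
    and small: "\<And>j. emeasure (density cube_lebesgue (\<lambda>z. ennreal (p_Z z))) {z \<in> unit_cube. k z = j}
        \<le> ennreal (\<epsilon> / real n)"
    using small_cells[OF assms(2), of "\<epsilon> / real n"] assms(1,5) by auto
  define q where "q S = sign_tilt g k S" for S
  define P where "P S = joint_law p_Z (q S)" for S
  define C where "C = P ` Pow {..N}"
  define p_XZ where "p_XZ Q = q (SOME S. P S = Q)" for Q
  have dens: "is_cube_density (\<lambda>x. q S x z)" for S z
    unfolding q_def g_def by (rule sign_tilt_density[OF c(1,2)])
  have q_meas: "(\<lambda>(x, z). q S x z) \<in> borel_measurable joint_cube" for S
    unfolding q_def by (rule sign_tilt_measurable[OF g k])
  note law = joint_law_properties[OF assms(2) q_meas dens, folded P_def]
  have rep: "\<exists>T. p_XZ (P S) = q T \<and> P T = P S" for S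
    unfolding p_XZ_def by (rule exI, rule conjI[OF refl someI[of "\<lambda>T. P T = P S"]]) simp
  have cond: "is_conditional_density (P S) p_Z (p_XZ (P S))" for S
    using rep[of S] law(3) by metis
  have smooth: "holder_smooth W\<^sub>1 \<beta> (q S)" for S
    unfolding q_def g_def by (rule sign_tilt_holder[OF assms(3,4) c(1,3)])
  have risk: "ennreal (kappa CARD('dx) \<beta> W\<^sub>1 - \<epsilon>) \<le> Max ((\<lambda>P. L1_risk n p_Z P (p_XZ P) p_hat) ` C)"
    if p_hat: "p_hat \<in> estimators n" for p_hat
  proof -
    obtain S where S: "S \<subseteq> {..N}" and le: "ennreal (1 - real n * (\<epsilon> / real n))
          * (\<integral>\<^sup>+ x. ennreal \<bar>g x\<bar> \<partial>cube_lebesgue) \<le> L1_risk n p_Z (P S) (q S) p_hat"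
      using tilted_family_risk[OF assms(2) g k finite_atMost, of N "\<epsilon> / real n" p_hat n]
        kN small dens p_hat assms(5) by (auto simp: q_def P_def)
    have "\<epsilon> * (c / 6) \<le> \<epsilon> * 1" using c assms(5) by (intro mult_left_mono) auto
    then have "kappa CARD('dx) \<beta> W\<^sub>1 - \<epsilon> \<le> (1 - \<epsilon>) * (c / 6)"
      using \<kappa> by (simp add: algebra_simps)
    then have "ennreal (kappa CARD('dx) \<beta> W\<^sub>1 - \<epsilon>) \<le> ennreal (1 - \<epsilon>) * ennreal (c / 6)"
      using c by (simp add: ennreal_leI flip: ennreal_mult'')
    also have "\<dots> \<le> ennreal (1 - \<epsilon>) * (\<integral>\<^sup>+ x. ennreal \<bar>g x\<bar> \<partial>cube_lebesgue)"
      unfolding g_def using nn_integral_abs_profile[OF c(1)] by (rule mult_left_mono) simp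
    also have "\<dots> \<le> L1_risk n p_Z (P S) (q S) p_hat" using le assms(1) by simp
    also have "\<dots> = L1_risk n p_Z (P S) (p_XZ (P S)) p_hat"
      unfolding L1_risk_def
    proof (rule nn_integral_cong)
      fix \<omega> assume \<omega>: "\<omega> \<in> space (PiM {..<n} (\<lambda>_. P S))"
      have "space (PiM {..<n} (\<lambda>_. P S)) = space (PiM {..<n} (\<lambda>_. joint_cube))"
        by (intro sets_eq_imp_space_eq sets_PiM_cong) (simp_all add: P_def joint_law_def)
      with \<omega> have "\<omega> \<in> space (PiM {..<n} (\<lambda>_. joint_cube))" by simp
      then show "L1_loss p_Z (p_hat \<omega>) (q S) = L1_loss p_Z (p_hat \<omega>) (p_XZ (P S))"
        by (intro L1_loss_conditional_density_unique[OF assms(2) law(3) cond]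
            estimator_section_measurable[OF p_hat])
    qed
    also have "\<dots> \<le> Max ((\<lambda>P. L1_risk n p_Z P (p_XZ P) p_hat) ` C)"
      using S by (intro Max_ge) (auto simp: C_def)
    finally show ?thesis .
  qed
  show ?thesis
  proof (intro exI[of _ C] exI[of _ p_XZ] conjI ballI)
    show "finite C" "C \<noteq> {}" by (auto simp: C_def)
    fix Q assume "Q \<in> C"
    then obtain S where Q: "Q = P S" by (auto simp: C_def)
    show "ac_distribution Q" "has_Z_marginal_density Q p_Z" using law(1,2) Q by auto
    show "is_conditional_density Q p_Z (p_XZ Q)" using cond Q by simp
    show "holder_smooth W\<^sub>1 \<beta> (p_XZ Q)" using smooth rep[of S] Q by metis
  next
    show "ennreal (kappa CARD('dx) \<beta> W\<^sub>1 - \<epsilon>)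
        \<le> (INF p_hat\<in>estimators n. Max ((\<lambda>P. L1_risk n p_Z P (p_XZ P) p_hat) ` C))"
      using risk by (rule INF_greatest)
  qed
qed

end
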